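(* For every nonnegative integer $n$, let $GG_1(n)$ denote the number of partitions of $n$ in which any two consecutive parts differ by at least $2$, and by at least $4$ if both are even. Let $GG'_{-1}(n)$ denote the number of signed partitions of $n$ in which the positive parts are even and differ pairwise by at least $4$, and the negative parts are odd, distinct and each at most $2\ell^+-1$, where $\ell^+$ is the number of positive parts. Then $GG'_{-1}(n)=GG_1(n)$ for all $n\ge 0$.
   Context: A partition of an integer $n$ is a finite nonincreasing sequence of positive integers (its parts) summing to $n$. A signed partition of an integer $n$ is a pair $(\pi,\nu)$ of ordinary partitions with $|\pi|-|\nu|=n$, where $|\cdot|$ denotes the sum of parts; the parts of $\pi$ are the positive parts and the parts of $\nu$ are the negative parts (their sizes). $\ell^+$ denotes the number of positive parts of a signed partition. *)

theory Defs
  imports Main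
begin

definition is_partition :: "nat list \<Rightarrow> bool" where
  "is_partition xs \<longleftrightarrow> sorted_wrt (\<ge>) xs \<and> (\<forall>x\<in>set xs. 0 < x)"

definition partitions_of :: "nat \<Rightarrow> nat list set" where
  "partitions_of n = {xs. is_partition xs \<and> sum_list xs = n}"

(* A pair (pi, nu): the entries of nu are the sizes of the negative parts. *)
definition signed_partitions_of :: "int \<Rightarrow> (nat list \<times> nat list) set" where
  "signed_partitions_of n =
     {(pi, nu). is_partition pi \<and> is_partition nu \<and> int (sum_list pi) - int (sum_list nu) = n}"

definition GG1 :: "nat \<Rightarrow> nat" where
  "GG1 n = card {xs \<in> partitions_of n.
     \<forall>i. Suc i < length xs \<longrightarrow>
       int (xs ! i) - int (xs ! Suc i) \<ge> 2 \<and>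
       (even (xs ! i) \<and> even (xs ! Suc i) \<longrightarrow> int (xs ! i) - int (xs ! Suc i) \<ge> 4)}"

(* The bound on the negative parts is stated over the integers, so that for no positive parts
   it reads x \<le> -1. The set is finite: with l positive parts, the positive parts sum to at least
   2 l^2 and the negative parts to at most l^2. *)
definition GG'_minus1 :: "int \<Rightarrow> nat" where
  "GG'_minus1 n = card {(pi, nu) \<in> signed_partitions_of n.
     (\<forall>x\<in>set pi. even x) \<and>
     (\<forall>i j. i < j \<and> j < length pi \<longrightarrow> int (pi ! i) - int (pi ! j) \<ge> 4) \<and>
     (\<forall>x\<in>set nu. odd x) \<and>
     distinct nu \<and>
     (\<forall>x\<in>set nu. int x \<le> 2 * int (length pi) - 1)}"

end

theory Submission
  imports Defs
begin

text \<open>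
  Let \<open>x\<^sub>1 > x\<^sub>2 > \<dots> > x\<^sub>l\<close> be a partition counted by \<open>GG1\<close>. Give every odd \<open>x\<^sub>i\<close> the extra weight
  \<open>2 i - 1\<close>, adding \<open>1\<close> to \<open>x\<^sub>i\<close> itself and \<open>2\<close> to each of the \<open>i - 1\<close> larger parts, and record
  \<open>2 i - 1\<close> as a negative part. The new parts are even, and two neighbours at distance \<open>d\<close> move to
  distance \<open>d\<close> plus the number of odd ones among them. Hence the new distance is at least \<open>4\<close>
  exactly if \<open>d\<close> was admissible. The negative parts tell which \<open>x\<^sub>i\<close> were odd, so that the
  construction can be undone from the smallest part upwards.
\<close>

definition gg_gap :: "nat \<Rightarrow> nat \<Rightarrow> bool" where
  "gg_gap x y \<longleftrightarrow> y + 2 \<le> x \<and> (even x \<and> even y \<longrightarrow> y + 4 \<le> x)"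

definition gg_partitions :: "nat list set" where
  "gg_partitions = {xs. successively gg_gap xs \<and> (\<forall>x\<in>set xs. 0 < x)}"

definition even_gap4_partitions :: "nat list set" where
  "even_gap4_partitions =
     {ps. successively (\<lambda>x y. y + 4 \<le> x) ps \<and> (\<forall>x\<in>set ps. 0 < x \<and> even x)}"

definition gg_signed_partitions :: "(nat list \<times> nat list) set" where
  "gg_signed_partitions =
     {(ps, ns). ps \<in> even_gap4_partitions \<and>
       sorted_wrt (>) ns \<and> (\<forall>x\<in>set ns. odd x \<and> x < 2 * length ps)}"

primrec positive_parts :: "nat list \<Rightarrow> nat list" where
  "positive_parts [] = []"
| "positive_parts (x # xs) =
     (x + of_bool (odd x) + 2 * length (filter odd xs)) # positive_parts xs"

definition negative_parts :: "nat list \<Rightarrow> nat list" where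
  "negative_parts xs = rev (map (\<lambda>i. 2 * i + 1) (filter (\<lambda>i. odd (xs ! i)) [0..<length xs]))"

definition signed_parts :: "nat list \<Rightarrow> nat list \<times> nat list" where
  "signed_parts xs = (positive_parts xs, negative_parts xs)"

lemma length_positive_parts [simp]: "length (positive_parts xs) = length xs"
  by (induction xs) auto

lemma even_positive_parts: "p \<in> set (positive_parts xs) \<Longrightarrow> even p"
  by (induction xs) auto

lemma gap4_rounded_iff_gg_gap:
  "y + of_bool (odd y) + 4 \<le> x + of_bool (odd x) + 2 * of_bool (odd y) \<longleftrightarrow> gg_gap x y"
proof -
  have "x \<noteq> y + 2" if "odd x \<noteq> odd y"
    using that by auto
  then show ?thesis
    by (cases "odd x"; cases "odd y") (auto simp: gg_gap_def)
qed

lemma successively_gap4_positive_parts: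
  "successively (\<lambda>x y. y + 4 \<le> x) (positive_parts xs) \<longleftrightarrow> successively gg_gap xs"
proof (induction xs rule: induct_list012)
  case (3 x y zs)
  then show ?case
    using gap4_rounded_iff_gg_gap[of y x] by auto
qed auto

lemma positive_parts_pos_iff:
  assumes "successively gg_gap xs"
  shows "(\<forall>p\<in>set (positive_parts xs). 0 < p) \<longleftrightarrow> (\<forall>x\<in>set xs. 0 < x)"
  using assms by (induction xs rule: induct_list012) (auto simp: gg_gap_def intro: odd_pos)

lemma positive_parts_in_even_gap4_iff:
  "positive_parts xs \<in> even_gap4_partitions \<longleftrightarrow> xs \<in> gg_partitions"
  unfolding even_gap4_partitions_def gg_partitions_def
  using successively_gap4_positive_parts positive_parts_pos_iff even_positive_parts by auto

lemma odd_mem_negative_parts_iff: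
  "2 * i + 1 \<in> set (negative_parts xs) \<longleftrightarrow> i < length xs \<and> odd (xs ! i)"
  by (auto simp: negative_parts_def)

lemma negative_parts_odd_less:
  "m \<in> set (negative_parts xs) \<Longrightarrow> odd m \<and> m < 2 * length xs"
  by (auto simp: negative_parts_def)

lemma sorted_negative_parts: "sorted_wrt (>) (negative_parts xs)"
  by (simp add: negative_parts_def sorted_wrt_rev sorted_wrt_map sorted_wrt_filter)

lemma negative_parts_Cons:
  "negative_parts (x # xs) = map (\<lambda>m. m + 2) (negative_parts xs) @ (if odd x then [1] else [])"
proof -
  have "[0..<length (x # xs)] = 0 # map Suc [0..<length xs]"
    by (simp add: map_Suc_upt upt_conv_Cons del: upt_Suc)
  then show ?thesis
    by (simp add: negative_parts_def filter_map rev_map o_def)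
qed

lemma length_negative_parts: "length (negative_parts xs) = length (filter odd xs)"
  by (induction xs) (simp_all add: negative_parts_Cons, simp add: negative_parts_def)

lemma sum_list_positive_parts:
  "sum_list (positive_parts xs) = sum_list xs + sum_list (negative_parts xs)"
proof (induction xs)
  case Nil
  show ?case by (simp add: negative_parts_def)
next
  case (Cons x xs)
  have "sum_list (map (\<lambda>m. m + 2) (negative_parts xs)) =
      sum_list (negative_parts xs) + 2 * length (filter odd xs)"
    by (simp add: sum_list_Suc length_negative_parts)
  with Cons show ?case
    by (simp add: negative_parts_Cons)
qed

lemma eq_if_positive_parts_parities_eq:
  assumes "positive_parts xs = positive_parts ys" and "map odd xs = map odd ys"
  shows "xs = ys"
proof -
  have "length xs = length ys"
    using assms(2) by (rule map_eq_imp_length_eq)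
  then show ?thesis
    using assms by (induction xs ys rule: list_induct2) auto
qed

lemma ex_positive_parts_parities:
  assumes "length ps = length bs" and "ps \<in> even_gap4_partitions"
  shows "\<exists>xs. positive_parts xs = ps \<and> map odd xs = bs"
  using assms
proof (induction ps bs rule: list_induct2)
  case Nil
  show ?case by simp
next
  case (Cons p ps b bs)
  then have "ps \<in> even_gap4_partitions"
    by (auto simp: even_gap4_partitions_def successively_Cons)
  then obtain xs where xs: "positive_parts xs = ps" "map odd xs = bs"
    using Cons.IH by blast
  define x where "x = p - (of_bool b + 2 * length (filter odd xs))"
  have "even p" "0 < p" and hd_ps: "ps \<noteq> [] \<Longrightarrow> hd ps + 4 \<le> p"
    using Cons.prems by (auto simp: even_gap4_partitions_def successively_Cons)
  have "of_bool b + 2 * length (filter odd xs) \<le> p"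
    \<comment> \<open>the next part is itself raised by \<open>2\<close> for every odd part after it\<close>
    using \<open>even p\<close> \<open>0 < p\<close> hd_ps xs(1) by (cases xs) auto
  then have "p = x + of_bool b + 2 * length (filter odd xs)"
    by (simp add: x_def)
  moreover from this \<open>even p\<close> have "odd x = b"
    by (cases b) auto
  ultimately have "positive_parts (x # xs) = p # ps \<and> map odd (x # xs) = b # bs"
    using xs by simp
  then show ?case ..
qed

lemma inj_signed_parts: "inj signed_parts"
proof (rule injI)
  fix xs ys
  assume "signed_parts xs = signed_parts ys"
  then have pos: "positive_parts xs = positive_parts ys"
    and neg: "negative_parts xs = negative_parts ys"
    by (simp_all add: signed_parts_def)
  have len: "length xs = length ys"
    using arg_cong[OF pos, of length] by simp
  have "odd (xs ! i) = odd (ys ! i)" if "i < length xs" for i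
    using odd_mem_negative_parts_iff[of i xs] odd_mem_negative_parts_iff[of i ys] neg len that
    by simp
  then have "map odd xs = map odd ys"
    by (simp add: list_eq_iff_nth_eq len)
  with pos show "xs = ys"
    by (rule eq_if_positive_parts_parities_eq)
qed

lemma signed_parts_in_gg_signed_iff: "signed_parts xs \<in> gg_signed_partitions \<longleftrightarrow> xs \<in> gg_partitions"
  using negative_parts_odd_less sorted_negative_parts
  by (auto simp: signed_parts_def gg_signed_partitions_def positive_parts_in_even_gap4_iff)

lemma gg_signed_partitions_subset_range: "gg_signed_partitions \<subseteq> range signed_parts"
proof (rule subrelI)
  fix ps ns
  assume "(ps, ns) \<in> gg_signed_partitions"
  then have ps_even_gap4: "ps \<in> even_gap4_partitions" and sorted: "sorted_wrt (>) ns"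
    and ns_odd_less: "\<And>m. m \<in> set ns \<Longrightarrow> odd m \<and> m < 2 * length ps"
    by (auto simp: gg_signed_partitions_def)
  have "length ps = length (map (\<lambda>i. 2 * i + 1 \<in> set ns) [0..<length ps])"
    by simp
  from ex_positive_parts_parities[OF this ps_even_gap4]
  obtain xs where pos: "positive_parts xs = ps"
    and parities: "map odd xs = map (\<lambda>i. 2 * i + 1 \<in> set ns) [0..<length ps]"
    by blast
  have len: "length ps = length xs"
    using pos by auto
  have "odd (xs ! i) \<longleftrightarrow> 2 * i + 1 \<in> set ns" if "i < length xs" for i
    using arg_cong[OF parities, of "\<lambda>bs. bs ! i"] that len by simp
  moreover have "i < length xs" if "2 * i + 1 \<in> set ns" for i
    using ns_odd_less[OF that] len by linarith
  ultimately have "2 * i + 1 \<in> set (negative_parts xs) \<longleftrightarrow> 2 * i + 1 \<in> set ns" for i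
    unfolding odd_mem_negative_parts_iff by blast
  then have "set (negative_parts xs) = set ns"
    using ns_odd_less negative_parts_odd_less[of _ xs] by (metis oddE subsetI subset_antisym)
  then have "rev (negative_parts xs) = rev ns"
    using sorted sorted_negative_parts[of xs]
    by (intro strict_sorted_equal) (simp_all add: sorted_wrt_rev)
  with pos show "(ps, ns) \<in> range signed_parts"
    by (auto simp: signed_parts_def)
qed

lemma bij_betw_signed_parts: "bij_betw signed_parts gg_partitions gg_signed_partitions"
proof (rule bij_betw_imageI)
  show "inj_on signed_parts gg_partitions"
    using inj_signed_parts by (rule inj_on_subset) simp
  show "signed_parts ` gg_partitions = gg_signed_partitions"
    using gg_signed_partitions_subset_range signed_parts_in_gg_signed_iff by blast
qed

lemma GG1_eq_card: "GG1 n = card {xs \<in> gg_partitions. sum_list xs = n}"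
proof -
  have gap: "int x - int y \<ge> 2 \<and> (even x \<and> even y \<longrightarrow> int x - int y \<ge> 4) \<longleftrightarrow> gg_gap x y" for x y
    by (auto simp: gg_gap_def)
  have "sorted_wrt (\<ge>) xs" if "successively gg_gap xs" for xs :: "nat list"
  proof -
    have "successively (\<ge>) xs"
      using that by (rule successively_mono) (auto simp: gg_gap_def)
    then show ?thesis
      by (simp add: successively_conv_sorted_wrt)
  qed
  then show ?thesis
    unfolding GG1_def gap successively_conv_nth[symmetric]
    by (auto simp: partitions_of_def is_partition_def gg_partitions_def intro!: arg_cong[of _ _ card])
qed

lemma even_gap4_partitions_iff:
  "ps \<in> even_gap4_partitions \<longleftrightarrow> is_partition ps \<and> (\<forall>x\<in>set ps. even x) \<and>
     (\<forall>i j. i < j \<and> j < length ps \<longrightarrow> int (ps ! i) - int (ps ! j) \<ge> 4)"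
proof -
  have "transp (\<lambda>x y :: nat. y + 4 \<le> x)"
    by (rule transpI) simp
  then have gap: "successively (\<lambda>x y. y + 4 \<le> x) ps \<longleftrightarrow> sorted_wrt (\<lambda>x y. y + 4 \<le> x) ps"
    by (rule successively_conv_sorted_wrt)
  have "int x - int y \<ge> 4 \<longleftrightarrow> y + 4 \<le> x" for x y :: nat
    by linarith
  then have pairwise: "(\<forall>i j. i < j \<and> j < length ps \<longrightarrow> int (ps ! i) - int (ps ! j) \<ge> 4) \<longleftrightarrow>
      sorted_wrt (\<lambda>x y. y + 4 \<le> x) ps"
    by (simp add: sorted_wrt_iff_nth_less imp_conjL)
  have "sorted_wrt (\<ge>) ps" if "sorted_wrt (\<lambda>x y. y + 4 \<le> x) ps"
    using that by (rule sorted_wrt_mono_rel[rotated]) simp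
  then show ?thesis
    unfolding even_gap4_partitions_def mem_Collect_eq is_partition_def gap pairwise
    by auto
qed

lemma sorted_greater_iff_distinct_partition:
  assumes "\<forall>x\<in>set ns. 0 < x"
  shows "sorted_wrt (>) ns \<longleftrightarrow> is_partition ns \<and> distinct ns"
  using assms strict_sorted_iff[of "rev ns"] by (simp add: is_partition_def sorted_wrt_rev)

lemma GG'_minus1_eq_card:
  "GG'_minus1 n =
     card {(ps, ns) \<in> gg_signed_partitions. int (sum_list ps) - int (sum_list ns) = n}"
proof -
  have bound: "int x \<le> 2 * int l - 1 \<longleftrightarrow> x < 2 * l" for x l :: nat
    by linarith
  have negative: "sorted_wrt (>) ns \<and> (\<forall>x\<in>set ns. odd x \<and> x < 2 * l) \<longleftrightarrow>
      is_partition ns \<and> (\<forall>x\<in>set ns. odd x) \<and> distinct ns \<and> (\<forall>x\<in>set ns. x < 2 * l)" for ns l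
    using sorted_greater_iff_distinct_partition[of ns] by (auto intro: odd_pos)
  show ?thesis
    unfolding GG'_minus1_def bound signed_partitions_of_def gg_signed_partitions_def
      even_gap4_partitions_iff negative
    by (rule arg_cong[of _ _ card]) auto
qed

theorem theorem4p2:
  fixes n :: nat
  shows "GG'_minus1 (int n) = GG1 n"
proof -
  have "bij_betw signed_parts {xs \<in> gg_partitions. sum_list xs = n}
    {(ps, ns) \<in> gg_signed_partitions. int (sum_list ps) - int (sum_list ns) = int n}"
    unfolding case_prod_unfold prod.collapse
    by (rule bij_betw_Collect[OF bij_betw_signed_parts])
      (simp add: signed_parts_def sum_list_positive_parts)
  then show ?thesis
    unfolding GG1_eq_card GG'_minus1_eq_card by (rule bij_betw_same_card[symmetric])
qed

end
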